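(* There exist a group $G$ of cardinality $\aleph_\omega$ and a 2-thin subset $A$ of $G$ such that, for every $m\in\mathbb{N}$, $A$ cannot be partitioned into $m$ thin subsets of $G$ (that is, $A$ cannot be finitely partitioned into thin subsets).
   Context: For a group $G$ and $m\in\mathbb{N}=\{1,2,\dots\}$, a subset $A\subseteq G$ is called $m$-thin if for each finite subset $F$ of $G$ there exists a finite subset $K$ of $G$ such that $|Fg\cap A|\leqslant m$ for every $g\in G\setminus K$, where $Fg=\{fg:f\in F\}$. A subset is called thin if it is 1-thin. *)

theory Defs
  imports "HOL-Algebra.Coset" "HOL-Library.Disjoint_Sets"
begin

unbundle cardinal_syntax

primrec card_is_aleph :: "nat \<Rightarrow> 'a set \<Rightarrow> bool" where
  "card_is_aleph 0 S \<longleftrightarrow> |S| =o natLeq"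
| "card_is_aleph (Suc n) S \<longleftrightarrow> (\<exists>T :: 'a set. card_is_aleph n T \<and> |S| =o cardSuc |T| )"

(* aleph_omega is the supremum of the aleph_n, i.e. the least cardinal above all of them.
   Every cardinal up to |X| is the cardinal of a subset of X, so it is enough to let Y range over
   the sets in the same type as X. *)
definition card_is_aleph_omega :: "'a set \<Rightarrow> bool" where
  "card_is_aleph_omega X \<longleftrightarrow>
     (\<forall>n. \<exists>S :: 'a set. card_is_aleph n S \<and> |S| \<le>o |X| ) \<and>
     (\<forall>Y :: 'a set. (\<forall>n. \<exists>S :: 'a set. card_is_aleph n S \<and> |S| \<le>o |Y| ) \<longrightarrow> |X| \<le>o |Y| )"

definition m_thin :: "('a, 'b) monoid_scheme \<Rightarrow> nat \<Rightarrow> 'a set \<Rightarrow> bool" where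
  "m_thin G m A \<longleftrightarrow> A \<subseteq> carrier G \<and>
     (\<forall>F. finite F \<and> F \<subseteq> carrier G \<longrightarrow>
       (\<exists>K. finite K \<and> K \<subseteq> carrier G \<and>
         (\<forall>g \<in> carrier G - K. card ((F #>\<^bsub>G\<^esub> g) \<inter> A) \<le> m)))"

abbreviation thin :: "('a, 'b) monoid_scheme \<Rightarrow> 'a set \<Rightarrow> bool" where
  "thin G A \<equiv> m_thin G 1 A"

(* Empty parts are allowed. If all parts had to be nonempty, A = {} would have no partition into
   m >= 1 parts. *)
definition partitionable_into_thin :: "('a, 'b) monoid_scheme \<Rightarrow> nat \<Rightarrow> 'a set \<Rightarrow> bool" where
  "partitionable_into_thin G m A \<longleftrightarrow>
     (\<exists>B :: nat \<Rightarrow> 'a set. (\<Union>i<m. B i) = A \<and> disjoint_family_on B {..<m} \<and>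
       (\<forall>i<m. thin G (B i)))"

end

theory Submission
  imports Defs
begin

text \<open>
  The group is a Boolean group: the finite subsets of a set of generators, under symmetric
  difference. For each \<open>M\<close>, think of a list \<open>xs\<close> of length \<open>M * M\<close> as a point with one coordinate,
  numbered \<open>a * M + b\<close>, for each directed edge \<open>(a, b)\<close> (loops included) on the vertices
  \<open>{..<M}\<close>. The set \<open>A\<close> consists of the two-element sets \<open>corner M i xs\<close>: one element is \<open>xs\<close>
  itself, the other is what remains of \<open>xs\<close> without the edges at \<open>i\<close>, tagged with \<open>M\<close> and \<open>i\<close>.
  For fixed \<open>xs\<close> these \<open>M\<close> elements form a complete graph whose edge between \<open>i\<close> and \<open>j\<close> is labelled
  by the group element \<open>corner M i xs + corner M j xs\<close>. The point cancels in this sum, and the only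
  coordinates of \<open>xs\<close> that leave no trace in it are those of \<open>(i, j)\<close> and \<open>(j, i)\<close>.

  Three corners of the same point determine the point, since no edge touches three vertices, and
  corners of different points \<open>xs\<close>, \<open>ys\<close> differ by an element that still mentions \<open>xs\<close> and \<open>ys\<close>.
  Hence finitely many differences leave only finitely many places where three elements of \<open>A\<close> can
  lie in one translate of a finite set, so \<open>A\<close> is 2-thin (\<open>two_thin_corners\<close>).

  Suppose that \<open>A\<close> is partitioned into \<open>m\<close> parts, and let \<open>M = m + 1\<close>. By the pigeonhole principle
  each point \<open>xs\<close> has two corners \<open>i \<noteq> j\<close> in the same part, and this assigns to \<open>xs\<close> the direction
  \<open>i * M + j\<close>. A theorem of Kuratowski says that when the coordinates range over sets of
  sufficiently large, strictly increasing infinite cardinalities, some line contains infinitely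
  many points to which its own direction is assigned (\<open>kuratowski_infinite_line\<close>). Along that
  line the label \<open>corner M i xs + corner M j xs\<close> is constant, so one part contains infinitely many
  pairs with the same difference and is not thin. With \<open>\<aleph>\<^sub>\<omega>\<close> elements there is room for the coordinate
  sets for all \<open>M\<close> at once.
\<close>

section \<open>Transport along isomorphisms\<close>

lemma m_thin_iso_image:
  assumes h: "h \<in> iso G H" and "group G" and A: "m_thin G m A"
  shows "m_thin H m (h ` A)"
proof -
  interpret group G by fact
  have hom: "h \<in> hom G H" and bij: "bij_betw h (carrier G) (carrier H)"
    using h by (auto simp: iso_def)
  have inj: "inj_on h (carrier G)" and im: "h ` carrier G = carrier H"
    using bij by (auto simp: bij_betw_def)
  have AG: "A \<subseteq> carrier G" using A by (simp add: m_thin_def)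
  show ?thesis unfolding m_thin_def
  proof (intro conjI allI impI)
    show "h ` A \<subseteq> carrier H" using AG im by auto
    fix F assume F: "finite F \<and> F \<subseteq> carrier H"
    define F' where "F' = {f \<in> carrier G. h f \<in> F}"
    have "finite F'"
      using finite_vimage_IntI[of F h "carrier G"] F inj
      by (simp add: F'_def vimage_def Int_def conj_commute)
    then obtain K where K: "finite K" "K \<subseteq> carrier G"
      "\<And>g. g \<in> carrier G - K \<Longrightarrow> card ((F' #>\<^bsub>G\<^esub> g) \<inter> A) \<le> m"
      using A unfolding m_thin_def F'_def by (metis (lifting) mem_Collect_eq subsetI)
    show "\<exists>K. finite K \<and> K \<subseteq> carrier H \<and>
        (\<forall>g\<in>carrier H - K. card ((F #>\<^bsub>H\<^esub> g) \<inter> h ` A) \<le> m)"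
    proof (intro exI[of _ "h ` K"] conjI ballI)
      show "finite (h ` K)" using K by simp
      show "h ` K \<subseteq> carrier H" using K im by auto
      fix g assume g: "g \<in> carrier H - h ` K"
      then obtain g' where g': "g' \<in> carrier G" "g = h g'" "g' \<notin> K" using im by auto
      have fin: "finite ((F' #>\<^bsub>G\<^esub> g') \<inter> A)" using \<open>finite F'\<close> by (auto simp: r_coset_def)
      have "(F #>\<^bsub>H\<^esub> g) \<inter> h ` A \<subseteq> h ` ((F' #>\<^bsub>G\<^esub> g') \<inter> A)"
      proof
        fix y assume "y \<in> (F #>\<^bsub>H\<^esub> g) \<inter> h ` A"
        then obtain f a where f: "f \<in> F" "y = f \<otimes>\<^bsub>H\<^esub> g" and a: "a \<in> A" "y = h a"
          by (auto simp: r_coset_def)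
        obtain f' where f': "f' \<in> carrier G" "f = h f'" using f F im by blast
        have "h (f' \<otimes>\<^bsub>G\<^esub> g') = h a" using f f' g' a hom_mult[OF hom, of f' g'] by simp
        hence "f' \<otimes>\<^bsub>G\<^esub> g' = a" using inj f' g' a AG by (auto dest!: inj_onD)
        moreover have "f' \<otimes>\<^bsub>G\<^esub> g' \<in> F' #>\<^bsub>G\<^esub> g'" using f f' by (auto simp: F'_def r_coset_def)
        ultimately show "y \<in> h ` ((F' #>\<^bsub>G\<^esub> g') \<inter> A)" using a by blast
      qed
      hence "card ((F #>\<^bsub>H\<^esub> g) \<inter> h ` A) \<le> card ((F' #>\<^bsub>G\<^esub> g') \<inter> A)"
        using fin by (meson card_image_le card_mono finite_imageI le_trans)
      also have "\<dots> \<le> m" using K g' by simp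
      finally show "card ((F #>\<^bsub>H\<^esub> g) \<inter> h ` A) \<le> m" .
    qed
  qed
qed

lemma partitionable_into_thin_iso_image:
  assumes h: "h \<in> iso G H" and G: "group G" and P: "partitionable_into_thin G m A"
  shows "partitionable_into_thin H m (h ` A)"
proof -
  obtain B :: "nat \<Rightarrow> _" where B: "(\<Union>i<m. B i) = A" "disjoint_family_on B {..<m}"
    "\<forall>i<m. thin G (B i)"
    using P unfolding partitionable_into_thin_def by blast
  have inj: "inj_on h (carrier G)" using h by (auto simp: iso_def bij_betw_def)
  have BG: "B i \<subseteq> carrier G" if "i < m" for i using B that by (auto simp: m_thin_def)
  have "h ` B i \<inter> h ` B j = {}" if "i < m" "j < m" "i \<noteq> j" for i j
  proof -
    have "h ` B i \<inter> h ` B j = h ` (B i \<inter> B j)"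
      using inj_on_image_Int[OF inj] BG that by metis
    thus ?thesis using B that by (auto simp: disjoint_family_on_def)
  qed
  hence "disjoint_family_on (\<lambda>i. h ` B i) {..<m}" by (auto simp: disjoint_family_on_def)
  moreover have "(\<Union>i<m. h ` B i) = h ` A" using B(1) by auto
  moreover have "\<forall>i<m. thin H (h ` B i)" using B(3) m_thin_iso_image[OF h G] by blast
  ultimately show ?thesis unfolding partitionable_into_thin_def by blast
qed

lemma group_transport_along_bij:
  assumes "group G" and bij: "bij_betw h (carrier G) X"
  obtains H :: "'b monoid" where "group H" "carrier H = X" "h \<in> iso G H"
proof -
  interpret group G by fact
  define u where "u = the_inv_into (carrier G) h"
  define H where "H = \<lparr>carrier = X, mult = (\<lambda>a b. h (u a \<otimes>\<^bsub>G\<^esub> u b)), one = h \<one>\<^bsub>G\<^esub>\<rparr>"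
  have "h \<in> iso G H"
    using bij by (auto simp: iso_def hom_def H_def u_def bij_betw_def the_inv_into_f_f)
  moreover from iso_imp_img_group[OF this] have "group H" by (simp add: H_def)
  ultimately show thesis using that by (simp add: H_def)
qed

section \<open>Cardinal arithmetic\<close>

lemma card_of_finite_ordLess_infinite: "finite A \<Longrightarrow> infinite B \<Longrightarrow> |A| <o |B|"
  using card_of_ordLeq_finite[of B A]
    not_ordLeq_iff_ordLess[OF card_of_Well_order card_of_Well_order, of B A]
  by argo

lemma card_of_Times_ordLeq_infinite:
  assumes "infinite C" "|A| \<le>o |C|" "|B| \<le>o |C|"
  shows "|A \<times> B| \<le>o |C|"
  using assms by (intro card_of_Times_ordLeq_infinite_Field card_of_Card_order)
    (simp_all only: Field_card_of not_False_eq_True)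

lemma card_is_aleph_unique:
  fixes S T :: "'a set"
  shows "card_is_aleph n S \<Longrightarrow> card_is_aleph n T \<Longrightarrow> |S| =o |T|"
proof (induction n arbitrary: S T)
  case 0
  thus ?case using ordIso_symmetric ordIso_transitive by (metis card_is_aleph.simps(1))
next
  case (Suc n)
  then obtain S' T' :: "'a set" where *: "card_is_aleph n S'" "|S| =o cardSuc |S'|"
    "card_is_aleph n T'" "|T| =o cardSuc |T'|" unfolding card_is_aleph.simps by blast
  hence "|S'| =o |T'|" using Suc.IH by blast
  hence "cardSuc |S'| =o cardSuc |T'|" by (simp add: cardSuc_invar_ordIso card_of_Card_order)
  thus ?case using * ordIso_symmetric ordIso_transitive by metis
qed

lemma card_is_aleph_less_Suc:
  fixes S T :: "'a set"
  assumes "card_is_aleph n S" "card_is_aleph (Suc n) T"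
  shows "|S| <o |T|"
proof -
  obtain S' :: "'a set" where *: "card_is_aleph n S'" "|T| =o cardSuc |S'|"
    using assms(2) unfolding card_is_aleph.simps by blast
  have "|S| =o |S'|" using card_is_aleph_unique assms * by blast
  moreover have "|S'| <o cardSuc |S'|" by (simp add: cardSuc_greater card_of_Card_order)
  ultimately show ?thesis using *
    by (meson ordIso_ordLess_trans ordIso_symmetric ordLess_ordIso_trans)
qed

lemma card_is_aleph_omega_chain:
  assumes "card_is_aleph_omega X"
  obtains Y :: "nat \<Rightarrow> 'a set"
  where "infinite (Y 0)" "\<And>n. |Y n| <o |Y (Suc n)|" "\<And>n. Y n \<subseteq> (X :: 'a set)"
proof -
  have "\<exists>Z. \<exists>S :: 'a set. Z \<subseteq> X \<and> card_is_aleph n S \<and> |S| =o |Z|" for n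
  proof -
    obtain S :: "'a set" where "card_is_aleph n S" "|S| \<le>o |X|"
      using assms unfolding card_is_aleph_omega_def by blast
    moreover from iffD1[OF internalize_card_of_ordLeq2 this(2)]
    obtain Z where "Z \<subseteq> X" "|S| =o |Z|" by blast
    ultimately show ?thesis by blast
  qed
  then obtain Y S where Y: "\<And>n. Y n \<subseteq> X" and S: "\<And>n. card_is_aleph n (S n :: 'a set)"
    and eq: "\<And>n. |S n| =o |Y n|" by metis
  have "natLeq =o |Y 0|"
    using S[of 0] eq[of 0] by (metis card_is_aleph.simps(1) ordIso_symmetric ordIso_transitive)
  hence "infinite (Y 0)" using infinite_iff_natLeq_ordLeq ordIso_iff_ordLeq by blast
  moreover have "|Y n| <o |Y (Suc n)|" for n
    using card_is_aleph_less_Suc[OF S[of n] S[of "Suc n"]] eq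
    by (meson ordIso_ordLess_trans ordIso_symmetric ordLess_ordIso_trans)
  ultimately show thesis using that Y by blast
qed

lemma card_of_lists_ordLeq_infinite:
  assumes inf: "infinite X"
  shows "|lists X| \<le>o |X|"
proof -
  have *: "|{xs \<in> lists X. length xs = n}| \<le>o |X|" for n
  proof (induction n)
    case 0
    have "{xs \<in> lists X. length xs = 0} = {[]}" by auto
    thus ?case using inf by (metis card_of_singl_ordLeq finite.emptyI)
  next
    case (Suc n)
    let ?L = "{xs \<in> lists X. length xs = n}"
    have "{xs \<in> lists X. length xs = Suc n} = (\<lambda>(x, xs). x # xs) ` (X \<times> ?L)"
      by (force simp: length_Suc_conv image_iff)
    hence "|{xs \<in> lists X. length xs = Suc n}| \<le>o |X \<times> ?L|" by (simp only: card_of_image)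
    moreover have "|X \<times> ?L| \<le>o |X|"
      using inf Suc by (intro card_of_Times_ordLeq_infinite card_of_mono1) auto
    ultimately show ?case by (rule ordLeq_transitive)
  qed
  have "lists X = (\<Union>n. {xs \<in> lists X. length xs = n})" by auto
  moreover have "|\<Union>n. {xs \<in> lists X. length xs = n}| \<le>o |X|"
    using inf * by (intro card_of_UNION_ordLeq_infinite) (auto simp: infinite_iff_card_of_nat)
  ultimately show ?thesis by simp
qed

lemma card_of_Fpow_ordIso_infinite:
  assumes inf: "infinite X"
  shows "|Fpow X| =o |X|"
proof -
  have "Fpow X \<subseteq> set ` lists X" by (auto simp: Fpow_def image_iff lists_eq_set dest!: finite_list)
  hence "|Fpow X| \<le>o |lists X|" by (meson card_of_image card_of_mono1 ordLeq_transitive)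
  hence "|Fpow X| \<le>o |X|" using card_of_lists_ordLeq_infinite[OF inf] ordLeq_transitive by blast
  moreover have "(\<lambda>x. {x}) ` X \<subseteq> Fpow X" "inj_on (\<lambda>x. {x}) X" by (auto simp: Fpow_def)
  hence "|X| \<le>o |Fpow X|" using card_of_ordLeq by blast
  ultimately show ?thesis by (simp add: ordIso_iff_ordLeq)
qed

section \<open>Kuratowski's theorem on lines in boxes\<close>

definition box :: "(nat \<Rightarrow> 'a set) \<Rightarrow> nat \<Rightarrow> 'a list set" where
  "box Y k = {xs. length xs = k \<and> (\<forall>i<k. xs ! i \<in> Y i)}"

lemma box_Suc: "box Y (Suc k) = (\<lambda>(xs, x). xs @ [x]) ` (box Y k \<times> Y k)"
proof -
  have "ys \<in> (\<lambda>(xs, x). xs @ [x]) ` (box Y k \<times> Y k)" if "ys \<in> box Y (Suc k)" for ys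
  proof -
    have l: "length ys = Suc k" and n: "\<And>i. i < Suc k \<Longrightarrow> ys ! i \<in> Y i"
      using that by (auto simp: box_def)
    have "ys = take k ys @ [ys ! k]" using l by (simp add: take_Suc_conv_app_nth[symmetric])
    moreover have "take k ys \<in> box Y k" using l n by (auto simp: box_def)
    ultimately show ?thesis using n[of k] by (force simp: image_iff)
  qed
  thus ?thesis by (auto simp: box_def nth_append less_Suc_eq)
qed

context
  fixes Y :: "nat \<Rightarrow> 'a set"
  assumes inf0: "infinite (Y 0)" and less: "\<And>n. |Y n| <o |Y (Suc n)|"
begin

lemma infinite_chain: "infinite (Y n)"
proof (induction n)
  case (Suc n)
  thus ?case using less[of n] card_of_ordLeq_infinite ordLess_imp_ordLeq by blast
qed (rule inf0)

lemma card_of_box_ordLess: "|box Y k| <o |Y k|"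
proof (induction k)
  case 0
  have "box Y 0 = {[]}" by (auto simp: box_def)
  thus ?case using inf0 by (simp add: card_of_finite_ordLess_infinite)
next
  case (Suc k)
  have "|box Y (Suc k)| \<le>o |box Y k \<times> Y k|" by (simp only: box_Suc card_of_image)
  also have "|box Y k \<times> Y k| \<le>o |Y k|"
    using infinite_chain Suc
    by (intro card_of_Times_ordLeq_infinite ordLess_imp_ordLeq card_of_mono1) auto
  finally show ?case using less ordLeq_ordLess_trans by blast
qed

text \<open>
  If all lines in the last direction meet their own class in a finite set, then these classes
  exclude fewer than \<open>|Y k|\<close> last coordinates altogether, because the box of the other coordinates
  is smaller than \<open>Y k\<close>. So some slice avoids the last class completely, and the
  induction hypothesis applies to it. In dimension 0 there is a point but no direction for it.
\<close>

theorem kuratowski_infinite_line: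
  assumes "\<And>xs. xs \<in> box Y k \<Longrightarrow> c xs < k"
  shows "\<exists>e<k. \<exists>xs\<in>box Y k. infinite {x \<in> Y e. c (xs[e := x]) = e}"
  using assms
proof (induction k arbitrary: c)
  case 0
  have "[] \<in> box Y 0" by (simp add: box_def)
  thus ?case using "0.prems" by blast
next
  case (Suc k)
  define S where "S b = {x \<in> Y k. c (b @ [x]) = k}" for b
  show ?case
  proof (cases "\<exists>b\<in>box Y k. infinite (S b)")
    case True
    then obtain b where b: "b \<in> box Y k" "infinite (S b)" by blast
    obtain x where x: "x \<in> Y k" using infinite_chain[of k] by (metis finite.emptyI ex_in_conv)
    have len: "length b = k" using b by (simp add: box_def)
    have "b @ [x] \<in> box Y (Suc k)" using b x by (auto simp: box_Suc)
    moreover have "infinite {y \<in> Y k. c ((b @ [x])[k := y]) = k}"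
      using b(2) len by (simp add: S_def list_update_append)
    ultimately show ?thesis by blast
  next
    case False
    have "|\<Union>b\<in>box Y k. S b| <o |Y k|"
    proof (cases "finite (box Y k)")
      case True
      hence "finite (\<Union>b\<in>box Y k. S b)" using False by auto
      thus ?thesis using infinite_chain card_of_finite_ordLess_infinite by blast
    next
      case inf: False
      have "|S b| \<le>o |box Y k|" if "b \<in> box Y k" for b
        using False that inf card_of_finite_ordLess_infinite ordLess_imp_ordLeq by blast
      hence "|\<Union>b\<in>box Y k. S b| \<le>o |box Y k|"
        using inf card_of_mono1 by (intro card_of_UNION_ordLeq_infinite) auto
      thus ?thesis using card_of_box_ordLess ordLeq_ordLess_trans by blast
    qed
    hence "\<not> Y k \<subseteq> (\<Union>b\<in>box Y k. S b)" using card_of_mono1 not_ordLess_ordLeq by blast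
    then obtain x where x: "x \<in> Y k" "\<And>b. b \<in> box Y k \<Longrightarrow> c (b @ [x]) \<noteq> k"
      by (auto simp: S_def)
    have "c (b @ [x]) < k" if "b \<in> box Y k" for b
    proof -
      have "b @ [x] \<in> box Y (Suc k)" using that x by (auto simp: box_Suc)
      thus ?thesis using Suc.prems[of "b @ [x]"] x(2)[OF that] by simp
    qed
    from Suc.IH[of "\<lambda>b. c (b @ [x])", OF this] obtain e b where
      e: "e < k" "b \<in> box Y k" "infinite {y \<in> Y e. c (b[e := y] @ [x]) = e}" by blast
    have "length b = k" using e by (simp add: box_def)
    hence "infinite {y \<in> Y e. c ((b @ [x])[e := y]) = e}"
      using e by (simp add: list_update_append)
    moreover have "b @ [x] \<in> box Y (Suc k)" using e x by (auto simp: box_Suc)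
    ultimately show ?thesis using e(1) less_SucI by blast
  qed
qed

end

section \<open>The Boolean group of finite subsets\<close>

definition bool_group :: "'a set \<Rightarrow> 'a set monoid" where
  "bool_group S = \<lparr>carrier = Fpow S, mult = sym_diff, one = {}\<rparr>"

lemma bool_group_simps [simp]:
  "carrier (bool_group S) = Fpow S" "a \<otimes>\<^bsub>bool_group S\<^esub> b = sym_diff a b"
  "\<one>\<^bsub>bool_group S\<^esub> = {}"
  by (simp_all add: bool_group_def)

lemma group_bool_group: "group (bool_group S)"
  by (rule groupI) (auto simp: Fpow_def)

lemma r_coset_bool_group: "F #>\<^bsub>bool_group S\<^esub> g = (\<lambda>f. sym_diff f g) ` F"
  by (auto simp: r_coset_def)

section \<open>The corners\<close>

definition incident :: "nat \<Rightarrow> nat \<Rightarrow> nat \<Rightarrow> bool" where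
  "incident M i e \<longleftrightarrow> i = e div M \<or> i = e mod M"

definition forget :: "nat \<Rightarrow> nat \<Rightarrow> 'a list \<Rightarrow> 'a list" where
  "forget M i xs = map ((!) xs) (filter (\<lambda>e. \<not> incident M i e) [0..<M * M])"

type_synonym 'a generator = "'a list + nat \<times> nat \<times> 'a list"

definition generators :: "'a set \<Rightarrow> 'a generator set" where
  "generators X = lists X <+> (UNIV \<times> UNIV \<times> lists X)"

definition corner :: "nat \<Rightarrow> nat \<Rightarrow> 'a list \<Rightarrow> 'a generator set" where
  "corner M i xs = {Inl xs, Inr (M, i, forget M i xs)}"

definition corners :: "'a set \<Rightarrow> 'a generator set set" where
  "corners X = {corner M i xs | M i xs. i < M \<and> xs \<in> lists X \<and> length xs = M * M}"

lemma card_of_generators: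
  assumes inf: "infinite X"
  shows "|generators X| =o |X|"
proof -
  have L: "|lists X| \<le>o |X|" by (rule card_of_lists_ordLeq_infinite[OF inf])
  have nat: "|UNIV :: nat set| \<le>o |X|" using inf infinite_iff_card_of_nat by blast
  have "|(UNIV :: nat set) \<times> (UNIV :: nat set) \<times> lists X| \<le>o |X|"
    using inf L nat by (intro card_of_Times_ordLeq_infinite)
  hence "|generators X| \<le>o |X|"
    unfolding generators_def using inf L
    by (intro card_of_Plus_ordLeq_infinite_Field card_of_Card_order)
      (simp_all only: Field_card_of not_False_eq_True)
  moreover have "(\<lambda>x. Inl [x]) ` X \<subseteq> generators X" "inj_on (\<lambda>x. Inl [x] :: 'a generator) X"
    by (auto simp: generators_def inj_on_def)
  hence "|X| \<le>o |generators X|" using card_of_ordLeq by blast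
  ultimately show ?thesis by (simp add: ordIso_iff_ordLeq)
qed

lemma forget_list_update:
  assumes "incident M i e" shows "forget M i (xs[e := x]) = forget M i xs"
proof -
  have "xs[e := x] ! e' = xs ! e'" if "\<not> incident M i e'" for e'
    using assms that by (metis nth_list_update_neq)
  thus ?thesis by (auto simp: forget_def)
qed

lemma nth_in_forget:
  assumes "e < M * M" "\<not> incident M i e" shows "xs ! e \<in> set (forget M i xs)"
  using assms by (auto simp: forget_def)

lemma corners_subset_Fpow: "corners X \<subseteq> Fpow (generators X)"
proof -
  have "forget M i xs \<in> lists X" if "xs \<in> lists X" "length xs = M * M" for M i and xs :: "'a list"
    using that by (auto simp: forget_def in_lists_conv_set)
  thus ?thesis by (auto simp: corners_def corner_def generators_def Fpow_def)
qed

lemma square_eq_nat: "m * m = n * n \<longleftrightarrow> n = (m :: nat)"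
  by (simp flip: power2_eq_square) auto

text \<open>
  An edge misses at least one of three distinct vertices \<open>i\<close>, \<open>j\<close>, \<open>k\<close>, so each coordinate of
  \<open>xs\<close> occurs in one of the generators in which two of the three corners differ.
\<close>

lemma coordinates_of_three_corners:
  assumes "i \<noteq> j" "i \<noteq> k" "j \<noteq> k" "length xs = M * M"
  shows "set xs \<subseteq> set (forget M i xs) \<union> set (forget M j xs) \<union> set (forget M k xs)"
proof
  fix x assume "x \<in> set xs"
  then obtain e where e: "e < M * M" "x = xs ! e" using assms by (auto simp: in_set_conv_nth)
  have "\<not> incident M i e \<or> \<not> incident M j e \<or> \<not> incident M k e"
    using assms by (auto simp: incident_def)
  thus "x \<in> set (forget M i xs) \<union> set (forget M j xs) \<union> set (forget M k xs)"
    using e nth_in_forget by blast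
qed

text \<open>
  Differences made of generators in a finite set \<open>D\<close> leave only finitely many candidates for the
  corners: if two of the corners belong to different points, then these points are themselves
  generators in \<open>D\<close>, and if all three belong to one point, then its coordinates and \<open>M\<close> can be
  read off from the tagged generators in \<open>D\<close>.
\<close>

lemma corner_triples_finite:
  fixes D :: "'a generator set"
  assumes "finite D"
  obtains C where "finite C"
    "\<And>a b c. \<lbrakk>a \<in> corners X; b \<in> corners X; c \<in> corners X; a \<noteq> b; a \<noteq> c; b \<noteq> c;
       sym_diff a b \<subseteq> D; sym_diff a c \<subseteq> D; sym_diff b c \<subseteq> D\<rbrakk> \<Longrightarrow> a \<in> C"
proof -
  define Ms where "Ms = (\<lambda>g. fst (projr g)) ` D"
  define Z where "Z = (\<Union>g\<in>D. set (snd (snd (projr g))))"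
  define T where "T = projl ` D \<union> (\<Union>M\<in>Ms. {xs. set xs \<subseteq> Z \<and> length xs = M * M})"
  \<comment> \<open>Only finitely many \<open>M\<close> fit a given \<open>xs\<close>: \<open>M \<le> M * M = length xs\<close>.\<close>
  define C where "C = (\<Union>xs\<in>T. \<Union>M\<in>{..length xs}. (\<lambda>i. corner M i xs) ` {..<M})"
  have "finite Ms" "finite Z" using assms by (auto simp: Ms_def Z_def)
  hence "finite T" using assms by (auto simp: T_def finite_lists_length_eq)
  hence "finite C" by (auto simp: C_def)
  moreover have "a \<in> C"
    if mem: "a \<in> corners X" "b \<in> corners X" "c \<in> corners X"
      and neq: "a \<noteq> b" "a \<noteq> c" "b \<noteq> c"
      and sub: "sym_diff a b \<subseteq> D" "sym_diff a c \<subseteq> D" "sym_diff b c \<subseteq> D" for a b c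
  proof -
    obtain M i xs where a: "a = corner M i xs" "i < M" "length xs = M * M"
      using mem(1) unfolding corners_def by blast
    obtain M' j ys where b: "b = corner M' j ys" "j < M'" "length ys = M' * M'"
      using mem(2) unfolding corners_def by blast
    obtain M'' k zs where c: "c = corner M'' k zs" "k < M''" "length zs = M'' * M''"
      using mem(3) unfolding corners_def by blast
    have "xs \<in> T"
    proof (cases "xs = ys \<and> xs = zs")
      case False
      hence "Inl xs \<in> D" using sub(1,2) by (auto simp: a b c corner_def)
      thus ?thesis by (force simp: T_def)
    next
      case True
      hence "M * M = M' * M'" "M * M = M'' * M''" using a(3) b(3) c(3) True by metis+
      hence M: "M' = M" "M'' = M" by (simp_all only: square_eq_nat)
      have ne: "i \<noteq> j" "i \<noteq> k" "j \<noteq> k" using neq True M by (auto simp: a b c)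
      have D: "Inr (M, i, forget M i xs) \<in> D" "Inr (M, j, forget M j xs) \<in> D"
        "Inr (M, k, forget M k xs) \<in> D"
        using sub ne True M by (auto simp: a b c corner_def)
      hence "set (forget M i xs) \<subseteq> Z" "set (forget M j xs) \<subseteq> Z" "set (forget M k xs) \<subseteq> Z"
        by (force simp: Z_def)+
      hence "set xs \<subseteq> Z" using coordinates_of_three_corners[OF ne a(3)] by blast
      moreover have "M \<in> Ms" using D(1) by (force simp: Ms_def)
      ultimately show ?thesis using a(3) by (auto simp: T_def)
    qed
    moreover have "M \<le> length xs" using a by simp
    moreover have "a \<in> (\<lambda>i. corner M i xs) ` {..<M}" using a by simp
    ultimately show ?thesis unfolding C_def by blast
  qed
  ultimately show thesis using that by blast
qed

theorem two_thin_corners: "m_thin (bool_group (generators X)) 2 (corners X)"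
  unfolding m_thin_def bool_group_simps r_coset_bool_group
proof (intro conjI allI impI)
  show "corners X \<subseteq> Fpow (generators X)" by (rule corners_subset_Fpow)
  fix F assume F: "finite F \<and> F \<subseteq> Fpow (generators X)"
  hence "finite (\<Union>F)" by (auto simp: Fpow_def)
  then obtain C where C: "finite C"
    "\<And>a b c. \<lbrakk>a \<in> corners X; b \<in> corners X; c \<in> corners X; a \<noteq> b; a \<noteq> c; b \<noteq> c;
       sym_diff a b \<subseteq> \<Union>F; sym_diff a c \<subseteq> \<Union>F; sym_diff b c \<subseteq> \<Union>F\<rbrakk> \<Longrightarrow> a \<in> C"
    by (rule corner_triples_finite[where X = X]) blast
  define K where "K = (\<lambda>(f, a). sym_diff f a) ` (F \<times> C) \<inter> Fpow (generators X)"
  show "\<exists>K. finite K \<and> K \<subseteq> Fpow (generators X) \<and>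
      (\<forall>g\<in>Fpow (generators X) - K. card ((\<lambda>f. sym_diff f g) ` F \<inter> corners X) \<le> 2)"
  proof (intro exI[of _ K] conjI ballI)
    show "finite K" "K \<subseteq> Fpow (generators X)" using F C by (auto simp: K_def)
    fix g assume g: "g \<in> Fpow (generators X) - K"
    show "card ((\<lambda>f. sym_diff f g) ` F \<inter> corners X) \<le> 2" (is "card ?I \<le> 2")
    proof (rule ccontr)
      assume "\<not> card ?I \<le> 2"
      hence "3 \<le> card ?I" by simp
      then obtain I where I: "I \<subseteq> ?I" "card I = 3" by (meson obtain_subset_with_card_n)
      then obtain a b c where abc: "I = {a, b, c}" "a \<noteq> b" "a \<noteq> c" "b \<noteq> c"
        by (auto simp: card_3_iff)
      have mem: "a \<in> corners X" "b \<in> corners X" "c \<in> corners X" using I abc by auto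
      obtain p q r where f: "p \<in> F" "a = sym_diff p g" "q \<in> F" "b = sym_diff q g"
        "r \<in> F" "c = sym_diff r g" using I abc by auto
      have "a \<in> C"
      proof (rule C(2)[OF mem abc(2-4)])
        show "sym_diff a b \<subseteq> \<Union>F" "sym_diff a c \<subseteq> \<Union>F" "sym_diff b c \<subseteq> \<Union>F"
          using f(1,3,5) unfolding f(2,4,6) by blast+
      qed
      moreover have "g = sym_diff p a" using f(2) by auto
      ultimately have "g \<in> K" using g f(1) by (force simp: K_def)
      thus False using g by blast
    qed
  qed
qed

text \<open>
  The pair of \<open>a\<close> and \<open>f + a\<close> is the translate by \<open>a\<close> of the fixed finite set \<open>{0, f}\<close>, and it has
  two elements because \<open>f \<noteq> 0\<close>; so \<open>a\<close> lies in the exceptional set of \<open>{0, f}\<close>.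
\<close>

lemma thin_bool_group_finite_pairs:
  assumes thin: "thin (bool_group S) B" and f: "f \<in> Fpow S" "f \<noteq> {}"
  shows "finite {a \<in> B. sym_diff f a \<in> B}"
proof -
  have BS: "B \<subseteq> Fpow S" using thin by (simp add: m_thin_def)
  have "finite {{}, f} \<and> {{}, f} \<subseteq> Fpow S" using f by (auto simp: Fpow_def)
  then obtain K where K: "finite K"
    "\<And>g. g \<in> Fpow S - K \<Longrightarrow> card ((\<lambda>f. sym_diff f g) ` {{}, f} \<inter> B) \<le> 1"
    using thin unfolding m_thin_def bool_group_simps r_coset_bool_group by metis
  have "{a \<in> B. sym_diff f a \<in> B} \<subseteq> K"
  proof
    fix a assume a: "a \<in> {a \<in> B. sym_diff f a \<in> B}"
    have ne: "sym_diff f a \<noteq> a" using f(2) by auto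
    have "(\<lambda>f. sym_diff f a) ` {{}, f} \<inter> B = {a, sym_diff f a}" using a by auto
    hence "card ((\<lambda>f. sym_diff f a) ` {{}, f} \<inter> B) = 2" using ne by simp
    thus "a \<in> K" using K(2)[of a] a BS by force
  qed
  thus ?thesis using K(1) finite_subset by blast
qed

theorem corners_not_partitionable:
  assumes X: "card_is_aleph_omega X"
  shows "\<not> partitionable_into_thin (bool_group (generators X)) m (corners X)"
proof
  assume "partitionable_into_thin (bool_group (generators X)) m (corners X)"
  then obtain B :: "nat \<Rightarrow> _" where B: "(\<Union>t<m. B t) = corners X"
    and thin: "\<And>t. t < m \<Longrightarrow> thin (bool_group (generators X)) (B t)"
    unfolding partitionable_into_thin_def by blast
  obtain Y where Y: "infinite (Y 0)" "\<And>n. |Y n| <o |Y (Suc n)|" "\<And>n. Y n \<subseteq> X"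
    using card_is_aleph_omega_chain[OF X] by metis
  define M where "M = Suc m"
  have corner: "corner M i xs \<in> corners X" if "xs \<in> box Y (M * M)" "i < M" for i xs
  proof -
    have "length xs = M * M" "\<And>e. e < M * M \<Longrightarrow> xs ! e \<in> X" using that Y(3) by (auto simp: box_def)
    hence "xs \<in> lists X" by (auto simp: in_set_conv_nth)
    thus ?thesis using \<open>length xs = M * M\<close> that(2) unfolding corners_def by blast
  qed
  define same_part where "same_part t i j xs \<longleftrightarrow> corner M i xs \<in> B t \<and> corner M j xs \<in> B t" for t i j xs
  have "\<exists>i<M. \<exists>j<M. i \<noteq> j \<and> (\<exists>t<m. same_part t i j xs)" if xs: "xs \<in> box Y (M * M)" for xs
  proof -
    have "\<forall>i<M. \<exists>t<m. corner M i xs \<in> B t" using corner[OF xs] B by blast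
    then obtain t where t: "\<And>i. i < M \<Longrightarrow> t i < m \<and> corner M i xs \<in> B (t i)" by metis
    have "\<not> inj_on t {..<M}"
    proof
      assume "inj_on t {..<M}"
      moreover have "t ` {..<M} \<subseteq> {..<m}" using t by auto
      ultimately have "card {..<M} \<le> card {..<m}" by (meson card_inj_on_le finite_lessThan)
      thus False by (simp add: M_def)
    qed
    then obtain i j where "i < M" "j < M" "i \<noteq> j" "t i = t j" by (auto simp: inj_on_def)
    thus ?thesis using t[of i] t[of j] unfolding same_part_def by metis
  qed
  then obtain I J where IJ: "\<And>xs. xs \<in> box Y (M * M) \<Longrightarrow>
      I xs < M \<and> J xs < M \<and> I xs \<noteq> J xs \<and> (\<exists>t<m. same_part t (I xs) (J xs) xs)" by metis
  have direction: "I xs * M + J xs < M * M" if "xs \<in> box Y (M * M)" for xs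
  proof -
    have "I xs * M + J xs < Suc (I xs) * M" using IJ[OF that] by simp
    also have "\<dots> \<le> M * M" using IJ[OF that] by (intro mult_le_mono1) auto
    finally show ?thesis .
  qed
  from kuratowski_infinite_line[OF Y(1,2), of "M * M" "\<lambda>xs. I xs * M + J xs", OF direction]
  obtain e xs where
    e: "e < M * M" "xs \<in> box Y (M * M)"
      "infinite {x \<in> Y e. I (xs[e := x]) * M + J (xs[e := x]) = e}" (is "infinite ?L")
    by blast
  \<comment> \<open>At the points selected on this line it is always the corners \<open>i\<close> and \<open>j\<close> that share a part.
    Which part may vary from point to point, but some part \<open>t\<close> occurs infinitely often.\<close>
  define i where "i = e div M"
  define j where "j = e mod M"
  define f :: "'a generator set"
    where "f = {Inr (M, i, forget M i xs), Inr (M, j, forget M j xs)}"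
  have len: "length xs = M * M" using e(2) by (simp add: box_def)
  have line: "xs[e := x] \<in> box Y (M * M)" if "x \<in> ?L" for x
    using that e(1,2) by (auto simp: box_def nth_list_update)
  have dir: "i < M" "j < M" "i \<noteq> j" "\<exists>t<m. same_part t i j (xs[e := x])" if "x \<in> ?L" for x
  proof -
    have "e = J (xs[e := x]) + I (xs[e := x]) * M" using that by simp
    moreover have J: "J (xs[e := x]) < M" using IJ[OF line[OF that]] by blast
    ultimately have "i = (J (xs[e := x]) + I (xs[e := x]) * M) div M"
      "j = (J (xs[e := x]) + I (xs[e := x]) * M) mod M" by (simp_all only: i_def j_def)
    hence "I (xs[e := x]) = i" "J (xs[e := x]) = j" using J by simp_all
    thus "i < M" "j < M" "i \<noteq> j" "\<exists>t<m. same_part t i j (xs[e := x])"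
      using IJ[OF line[OF that]] by auto
  qed
  obtain t where t: "t < m" "infinite {x \<in> ?L. same_part t i j (xs[e := x])}"
    using pigeonhole_infinite_rel[OF e(3), of "{..<m}" "\<lambda>x t. same_part t i j (xs[e := x])"] dir(4)
    by auto
  obtain x0 where "x0 \<in> ?L" using e(3) by (metis ex_in_conv finite.emptyI)
  note ij = dir(1-3)[OF this]
  have update: "corner M i (xs[e := x]) = {Inl (xs[e := x]), Inr (M, i, forget M i xs)}"
    "corner M j (xs[e := x]) = {Inl (xs[e := x]), Inr (M, j, forget M j xs)}" for x
    by (simp_all add: corner_def forget_list_update incident_def i_def j_def)
  \<comment> \<open>The line changes only the coordinate of \<open>(i, j)\<close>, which corners \<open>i\<close> and \<open>j\<close> both forget.\<close>
  have diff: "sym_diff f (corner M i (xs[e := x])) = corner M j (xs[e := x])" for x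
    using ij(3) unfolding update f_def by auto
  have "f \<in> Fpow (generators X)"
    using corner[OF e(2) ij(1)] corner[OF e(2) ij(2)] corners_subset_Fpow
    by (force simp: f_def corner_def Fpow_def)
  moreover have "f \<noteq> {}" by (simp add: f_def)
  ultimately have "finite {a \<in> B t. sym_diff f a \<in> B t}"
    using thin_bool_group_finite_pairs thin[OF t(1)] by blast
  moreover have "(\<lambda>x. corner M i (xs[e := x])) ` {x \<in> ?L. same_part t i j (xs[e := x])}
      \<subseteq> {a \<in> B t. sym_diff f a \<in> B t}" (is "?c ` ?N \<subseteq> _")
    using diff by (auto simp: same_part_def)
  moreover have "inj_on ?c ?N"
  proof (rule inj_onI)
    fix x y assume "?c x = ?c y"
    hence "xs[e := x] = xs[e := y]" unfolding update by (auto simp: doubleton_eq_iff)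
    thus "x = y" using e(1) len by (metis nth_list_update_eq)
  qed
  ultimately show False using t(2) by (meson finite_imageD finite_subset)
qed

theorem mainTheorem2:
  assumes "\<exists>X :: 'a set. card_is_aleph_omega X"
  shows "\<exists>(G :: 'a monoid) A. group G \<and> card_is_aleph_omega (carrier G) \<and> m_thin G 2 A \<and>
           (\<forall>m::nat. m \<ge> 1 \<longrightarrow> \<not> partitionable_into_thin G m A)"
proof -
  obtain X :: "'a set" where X: "card_is_aleph_omega X" using assms by blast
  let ?B = "bool_group (generators X)"
  have "infinite X"
    using card_is_aleph_omega_chain[OF X] by (metis finite_subset)
  hence gen: "|generators X| =o |X|" by (rule card_of_generators)
  hence "infinite (generators X)" using \<open>infinite X\<close> card_of_ordIso_finite by blast
  hence "|carrier ?B| =o |X|"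
    using card_of_Fpow_ordIso_infinite gen ordIso_transitive by fastforce
  then obtain h where "bij_betw h (carrier ?B) X" using card_of_ordIso by blast
  then obtain G :: "'a monoid" where G: "group G" "carrier G = X" "h \<in> iso ?B G"
    using group_transport_along_bij[OF group_bool_group] by metis
  have h_inv: "inv_into (carrier ?B) h \<in> iso G ?B"
    by (rule group.iso_set_sym[OF group_bool_group G(3)])
  have h_inv_image: "inv_into (carrier ?B) h ` h ` corners X = corners X"
    using G(3) corners_subset_Fpow[of X]
    by (intro inv_into_image_cancel) (auto simp: iso_def bij_betw_def)
  have "\<not> partitionable_into_thin G m (h ` corners X)" for m
    using partitionable_into_thin_iso_image[OF h_inv G(1)] corners_not_partitionable[OF X] h_inv_image
    by metis
  moreover have "m_thin G 2 (h ` corners X)"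
    by (rule m_thin_iso_image[OF G(3) group_bool_group two_thin_corners])
  ultimately show ?thesis using G X by blast
qed

end
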